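(* The Veech homomorphism $V\colon \mathrm{Aff}(S_E)\to GL(2,\mathbb R)$, $\Psi\mapsto D\Psi$, is injective. Moreover, $\mathrm{Aff}(S_E)$ is generated by the three affine automorphisms $\Psi_\alpha,\Psi_\beta,\Psi_\gamma$ whose derivatives are $$\alpha=\begin{pmatrix}1&0\\0&-1\end{pmatrix},\qquad \beta=\begin{pmatrix}\tfrac12&\tfrac{\sqrt3}{2}\\ \tfrac{\sqrt3}{2}&-\tfrac12\end{pmatrix},\qquad \gamma=\begin{pmatrix}-1&2\sqrt3\\0&1\end{pmatrix}.$$ Consequently the Veech group $V(S_E)$ is generated by $\alpha,\beta,\gamma$.
   Context: Let $E$ be the regular hexagon of side length $1$, centred at the origin, with two horizontal sides. Gluing each pair of opposite parallel sides by the translation identifying them gives a translation surface $S_E$: a flat torus carrying two marked points, namely the two equivalence classes of vertices of $E$; let $\Sigma$ denote the set of these two marked points. An affine automorphism of $S_E$ is a homeomorphism $\Psi\colon S_E\to S_E$ such that: - $\Psi(\Sigma)=\Sigma$; - on $S_E\setminus\Sigma$, $\Psi$ is a diffeomorphism whose derivative, computed in the translation charts, is a constant matrix $D\Psi\in GL(2,\mathbb R)$. Orientation-reversing affine automorphisms are allowed. They form a group $\mathrm{Aff}(S_E)$. The Veech group $V(S_E)$ is the image of $\mathrm{Aff}(S_E)$ under $\Psi\mapsto D\Psi$; it is contained in the group of real $2\times 2$ matrices of determinant $\pm1$. *)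

theory Defs
  imports "HOL-Analysis.Analysis"
begin

text \<open>The regular hexagon E of side 1 centred at the origin with two horizontal sides has
vertices (1,0), (1/2, sqrt 3/2), (-1/2, sqrt 3/2), (-1,0), (-1/2,-sqrt 3/2), (1/2,-sqrt 3/2).
The side-gluing translations are (0, sqrt 3), (3/2, sqrt 3/2), (3/2, -sqrt 3/2); they generate
the lattice hex_lattice, and the glued surface S_E is the flat torus R^2 / hex_lattice.\<close>

definition hex_u :: "real^2" where "hex_u = vector [3/2, sqrt 3 / 2]"
definition hex_v :: "real^2" where "hex_v = vector [0, sqrt 3]"

definition hex_lattice :: "(real^2) set" where
  "hex_lattice = {of_int m *\<^sub>R hex_u + of_int n *\<^sub>R hex_v | m n. True}"

definition tor_rel :: "real^2 \<Rightarrow> real^2 \<Rightarrow> bool" where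
  "tor_rel x y \<longleftrightarrow> x - y \<in> hex_lattice"

lemma tor_rel_equivp: "equivp tor_rel"
proof (rule equivpI)
  show "reflp tor_rel"
    unfolding reflp_def tor_rel_def hex_lattice_def
    by (auto intro!: exI[of _ 0])
  show "symp tor_rel"
    unfolding symp_def tor_rel_def hex_lattice_def
  proof (intro allI impI)
    fix x y :: "real^2" assume "x - y \<in> {of_int m *\<^sub>R hex_u + of_int n *\<^sub>R hex_v | m n. True}"
    then obtain m n where "x - y = of_int m *\<^sub>R hex_u + of_int n *\<^sub>R hex_v" by auto
    then have "y - x = of_int (-m) *\<^sub>R hex_u + of_int (-n) *\<^sub>R hex_v"
      by (simp add: algebra_simps)
    then show "y - x \<in> {of_int m *\<^sub>R hex_u + of_int n *\<^sub>R hex_v | m n. True}" by blast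
  qed
  show "transp tor_rel"
    unfolding transp_def tor_rel_def hex_lattice_def
  proof (intro allI impI)
    fix x y z :: "real^2"
    assume "x - y \<in> {of_int m *\<^sub>R hex_u + of_int n *\<^sub>R hex_v | m n. True}"
       and "y - z \<in> {of_int m *\<^sub>R hex_u + of_int n *\<^sub>R hex_v | m n. True}"
    then obtain m n m' n' where a: "x - y = of_int m *\<^sub>R hex_u + of_int n *\<^sub>R hex_v"
      and b: "y - z = of_int m' *\<^sub>R hex_u + of_int n' *\<^sub>R hex_v" by auto
    have "x - z = (x - y) + (y - z)" by simp
    also have "\<dots> = of_int (m + m') *\<^sub>R hex_u + of_int (n + n') *\<^sub>R hex_v"
      unfolding a b by (simp add: algebra_simps)
    finally show "x - z \<in> {of_int m *\<^sub>R hex_u + of_int n *\<^sub>R hex_v | m n. True}" by blast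
  qed
qed

text \<open>The surface S_E as a type: points of R^2 modulo the lattice.\<close>
quotient_type hex_torus = "real^2" / tor_rel
  by (rule tor_rel_equivp)

text \<open>Quotient topology on S_E: U is open iff its preimage under the projection is open.\<close>
instantiation hex_torus :: topological_space
begin
definition open_hex_torus_def: "open (U :: hex_torus set) \<longleftrightarrow> open (abs_hex_torus -` U)"
instance
  by standard (auto simp: open_hex_torus_def vimage_Union intro: open_Union)
end

text \<open>The two marked points: the two classes of vertices of E.\<close>
definition hex_Sigma :: "hex_torus set" where
  "hex_Sigma = {abs_hex_torus (vector [1, 0]), abs_hex_torus (vector [-1, 0])}"

text \<open>Psi is an affine automorphism of S_E with derivative A: a homeomorphism preserving Sigma,
which in the translation charts (local inverses of the projection R^2 -> S_E) is, near every
point outside Sigma, an affine map x |-> A x + b with constant A in GL(2,R).\<close>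
definition is_affine_aut :: "(hex_torus \<Rightarrow> hex_torus) \<Rightarrow> real^2^2 \<Rightarrow> bool" where
  "is_affine_aut \<Psi> A \<longleftrightarrow>
     (\<exists>\<Psi>'. homeomorphism UNIV UNIV \<Psi> \<Psi>') \<and> \<Psi> ` hex_Sigma = hex_Sigma \<and> invertible A \<and>
     (\<forall>p. abs_hex_torus p \<notin> hex_Sigma \<longrightarrow>
        (\<exists>U b. open U \<and> p \<in> U \<and> (\<forall>x\<in>U. \<Psi> (abs_hex_torus x) = abs_hex_torus (A *v x + b))))"

definition Aff_SE :: "(hex_torus \<Rightarrow> hex_torus) set" where
  "Aff_SE = {\<Psi>. \<exists>A. is_affine_aut \<Psi> A}"

definition Veech_SE :: "(real^2^2) set" where
  "Veech_SE = {A. \<exists>\<Psi>. is_affine_aut \<Psi> A}"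

text \<open>Subgroup generated by a set G inside a group given by multiplication, unit and inverse.\<close>
inductive_set generated :: "('a \<Rightarrow> 'a \<Rightarrow> 'a) \<Rightarrow> 'a \<Rightarrow> ('a \<Rightarrow> 'a) \<Rightarrow> 'a set \<Rightarrow> 'a set"
  for mult one invf G where
  gen_one: "one \<in> generated mult one invf G"
| gen_base: "g \<in> G \<Longrightarrow> g \<in> generated mult one invf G"
| gen_mult: "f \<in> generated mult one invf G \<Longrightarrow> g \<in> generated mult one invf G \<Longrightarrow>
              mult f g \<in> generated mult one invf G"
| gen_inv: "f \<in> generated mult one invf G \<Longrightarrow> invf f \<in> generated mult one invf G"

definition mat_alpha :: "real^2^2" where
  "mat_alpha = vector [vector [1, 0], vector [0, -1]]"
definition mat_beta :: "real^2^2" where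
  "mat_beta = vector [vector [1/2, sqrt 3 / 2], vector [sqrt 3 / 2, -1/2]]"
definition mat_gamma :: "real^2^2" where
  "mat_gamma = vector [vector [-1, 2 * sqrt 3], vector [0, 1]]"

end

theory Submission
  imports Defs
begin

text \<open>An affine automorphism \<open>\<Psi>\<close> with derivative \<open>A\<close> lifts, near every point off the countable
  preimage of \<open>\<Sigma>\<close>, to some \<open>x \<mapsto> A x + b\<close>; the translation parts agree modulo the lattice
  \<open>\<Lambda>\<close> on overlaps, so connectedness of the complement of a countable set gives one global \<open>b\<close>
  off \<open>\<Sigma>\<close>, and continuity extends the formula everywhere. Injectivity of \<open>\<Psi>\<close> forces
  \<open>A \<Lambda> = \<Lambda>\<close>. The marked points are \<open>\<plusminus>[p]\<close> with \<open>p = (1, 0)\<close> and \<open>3 p \<in> \<Lambda>\<close>;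
  permuting them forces \<open>2 b, 3 b \<in> \<Lambda>\<close>, so \<open>b \<in> \<Lambda>\<close> and \<open>\<Psi>\<close> is determined by \<open>A\<close>.

  In the lattice basis \<open>e\<^sub>1 = u\<close>, \<open>e\<^sub>2 = u + v\<close> the point \<open>p\<close> has coordinates
  \<open>(1, -1/3)\<close>, and the admissible derivatives become the group \<open>\<Gamma>\<close> of integer matrices
  \<open>[[a, b], [c, d]]\<close> with determinant \<open>\<plusminus>1\<close> and \<open>3 | b\<close>; each of them does induce an affine
  automorphism. In these coordinates \<open>\<alpha> = [[2, 3], [-1, -2]]\<close>, \<open>\<beta> = [[1, 3], [0, -1]]\<close>,
  \<open>\<gamma> = [[1, 6], [0, -1]]\<close>, so \<open>\<beta>\<gamma> = [[1, 3], [0, 1]]\<close> and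
  \<open>(\<alpha>\<beta>)\<^sup>2 (\<beta>\<gamma>)\<^sup>-\<^sup>1 = [[1, 0], [-1, 1]]\<close>; a Euclidean descent on \<open>|c|\<close> with these
  unipotents shows that \<open>\<alpha>, \<beta>, \<gamma>\<close> generate \<open>\<Gamma>\<close>.\<close>

section \<open>General facts\<close>

lemma exists_symmetric_remainder:
  fixes x m :: int
  assumes "m \<noteq> 0"
  obtains q where "2 * \<bar>x + q * m\<bar> \<le> \<bar>m\<bar>"
proof -
  define n q0 r where "n = \<bar>m\<bar>" and "q0 = x div n" and "r = x mod n"
  have n: "n > 0"
    using assms by (simp add: n_def)
  have x: "x = q0 * n + r" and r: "0 \<le> r" "r < n"
    using n by (simp_all add: q0_def r_def)
  have "\<exists>q. 2 * \<bar>x + q * n\<bar> \<le> n"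
  proof (cases "2 * r \<le> n")
    case True
    then show ?thesis using r by (intro exI[of _ "- q0"]) (simp add: x)
  next
    case False
    then show ?thesis using r by (intro exI[of _ "- q0 - 1"]) (simp add: x algebra_simps)
  qed
  then obtain q where "2 * \<bar>x + q * n\<bar> \<le> n" ..
  moreover have "q * n = (q * sgn m) * m"
    using assms by (cases "m > 0") (auto simp: n_def)
  ultimately show thesis
    using that[of "q * sgn m"] by (simp only: n_def)
qed

lemma matrix_inv_eqI:
  fixes A B :: "'a::field^'n^'n"
  assumes "A ** B = mat 1"
  shows "matrix_inv A = B"
proof -
  have BA: "B ** A = mat 1"
    by (rule matrix_left_right_inverse1[OF assms])
  have "A ** matrix_inv A = mat 1 \<and> matrix_inv A ** A = mat 1"
    unfolding matrix_inv_def by (rule someI[where x = B]) (simp add: assms BA)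
  then have "matrix_inv A = (B ** A) ** matrix_inv A"
    by (simp add: BA)
  also have "\<dots> = B"
    using \<open>A ** matrix_inv A = mat 1 \<and> _\<close> by (simp add: matrix_mul_assoc[symmetric])
  finally show ?thesis .
qed

lemma invertible_matrix_inv_mult:
  assumes "invertible A"
  shows "A ** matrix_inv A = mat 1" "matrix_inv A ** A = mat 1"
  using someI_ex[OF assms[unfolded invertible_def]] by (simp_all add: matrix_inv_def)

lemma closure_Compl_countable:
  fixes P :: "'a::euclidean_space set"
  assumes "countable P"
  shows "closure (- P) = UNIV"
proof -
  have "\<exists>y\<in>- P. dist y x < e" if "e > 0" for x e
  proof -
    obtain y where "y \<in> ball x e" "y \<notin> P"
      using ball_minus_countable_nonempty[OF assms \<open>e > 0\<close>] by blast
    then show ?thesis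
      by (auto simp: dist_commute)
  qed
  then show ?thesis
    by (auto simp: closure_approachable)
qed

lemma continuous_eq_off_countable:
  fixes f g :: "'a::euclidean_space \<Rightarrow> 'b::t2_space"
  assumes "continuous_on UNIV f" "continuous_on UNIV g" "countable P" "\<And>x. x \<notin> P \<Longrightarrow> f x = g x"
  shows "f = g"
proof -
  have "closure (- P) \<subseteq> {x. f x = g x}"
    using assms by (intro closure_minimal closed_Collect_eq) auto
  then show ?thesis
    using closure_Compl_countable[OF assms(3)] by auto
qed

lemma int_family_in_generated:
  fixes F :: "int \<Rightarrow> 'a"
  assumes "\<And>i j. F (i + j) = mul (F i) (F j)" and "F 0 = one"
    and "F 1 \<in> generated mul one invf G" and "F (-1) \<in> generated mul one invf G"
  shows "F k \<in> generated mul one invf G"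
proof (induction k rule: int_induct[where k = 0])
  case base
  then show ?case using assms(2) generated.gen_one by metis
next
  case (step1 i)
  then show ?case using assms(1)[of i 1] assms(3) generated.gen_mult by metis
next
  case (step2 i)
  then show ?case using assms(1)[of i "-1"] assms(4) generated.gen_mult by (metis diff_conv_add_uminus)
qed

lemma generated_hom_image:
  assumes "\<And>x y. x \<in> generated mul one invf G \<Longrightarrow> y \<in> generated mul one invf G \<Longrightarrow>
      h (mul x y) = mul' (h x) (h y)"
    and "h one = one'"
    and "\<And>x. x \<in> generated mul one invf G \<Longrightarrow> h (invf x) = invf' (h x)"
  shows "h ` generated mul one invf G = generated mul' one' invf' (h ` G)"
proof
  have "h x \<in> generated mul' one' invf' (h ` G)" if "x \<in> generated mul one invf G" for x
    using that
  proof induction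
    case gen_one
    then show ?case by (simp add: assms(2) generated.gen_one)
  next
    case (gen_base g)
    then show ?case by (simp add: generated.gen_base)
  next
    case (gen_mult f g)
    then show ?case by (simp add: assms(1) generated.gen_mult)
  next
    case (gen_inv f)
    then show ?case by (simp add: assms(3) generated.gen_inv)
  qed
  then show "h ` generated mul one invf G \<subseteq> generated mul' one' invf' (h ` G)"
    by blast
  show "generated mul' one' invf' (h ` G) \<subseteq> h ` generated mul one invf G"
  proof
    fix y assume "y \<in> generated mul' one' invf' (h ` G)"
    then show "y \<in> h ` generated mul one invf G"
    proof induction
      case gen_one
      then show ?case by (metis assms(2) generated.gen_one imageI)
    next
      case (gen_base g)
      then show ?case by (auto intro: generated.gen_base)
    next
      case (gen_mult f g)
      then obtain x y where "x \<in> generated mul one invf G" "y \<in> generated mul one invf G" "f = h x" "g = h y"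
        by blast
      then show ?case
        by (metis assms(1) generated.gen_mult imageI)
    next
      case (gen_inv f)
      then obtain x where "x \<in> generated mul one invf G" "f = h x"
        by blast
      then show ?case
        by (metis assms(3) generated.gen_inv imageI)
    qed
  qed
qed

section \<open>Lattice coordinates\<close>

definition hex_e1 :: "real^2" where "hex_e1 = hex_u"

definition hex_e2 :: "real^2" where "hex_e2 = hex_u + hex_v"

definition hex_coord1 :: "real^2 \<Rightarrow> real" where "hex_coord1 x = x$1 - x$2 / sqrt 3"

definition hex_coord2 :: "real^2 \<Rightarrow> real" where "hex_coord2 x = x$2 / sqrt 3 - x$1 / 3"

lemma hex_coord_add:
    "hex_coord1 (x + y) = hex_coord1 x + hex_coord1 y" "hex_coord2 (x + y) = hex_coord2 x + hex_coord2 y"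
  and hex_coord_diff:
    "hex_coord1 (x - y) = hex_coord1 x - hex_coord1 y" "hex_coord2 (x - y) = hex_coord2 x - hex_coord2 y"
  and hex_coord_uminus: "hex_coord1 (- x) = - hex_coord1 x" "hex_coord2 (- x) = - hex_coord2 x"
  and hex_coord_scaleR:
    "hex_coord1 (r *\<^sub>R x) = r * hex_coord1 x" "hex_coord2 (r *\<^sub>R x) = r * hex_coord2 x"
  by (simp_all add: hex_coord1_def hex_coord2_def algebra_simps diff_divide_distrib add_divide_distrib)

lemma hex_coord_basis:
  "hex_coord1 hex_e1 = 1" "hex_coord2 hex_e1 = 0" "hex_coord1 hex_e2 = 0" "hex_coord2 hex_e2 = 1"
  by (simp_all add: hex_coord1_def hex_coord2_def hex_e1_def hex_e2_def hex_u_def hex_v_def field_simps)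

lemma hex_coord_uv:
  "hex_coord1 hex_u = 1" "hex_coord2 hex_u = 0" "hex_coord1 hex_v = -1" "hex_coord2 hex_v = 1"
  by (simp_all add: hex_coord1_def hex_coord2_def hex_u_def hex_v_def field_simps)

lemma hex_coord_decomp: "x = hex_coord1 x *\<^sub>R hex_e1 + hex_coord2 x *\<^sub>R hex_e2"
  by (simp add: vec_eq_iff forall_2 hex_coord1_def hex_coord2_def hex_e1_def hex_e2_def
      hex_u_def hex_v_def field_simps)

lemma hex_coord_eqI: "hex_coord1 x = hex_coord1 y \<Longrightarrow> hex_coord2 x = hex_coord2 y \<Longrightarrow> x = y"
  by (metis hex_coord_decomp)

lemma mem_hex_lattice_iff: "x \<in> hex_lattice \<longleftrightarrow> hex_coord1 x \<in> \<int> \<and> hex_coord2 x \<in> \<int>"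
proof
  assume "x \<in> hex_lattice"
  then obtain m n where "x = of_int m *\<^sub>R hex_u + of_int n *\<^sub>R hex_v"
    by (auto simp: hex_lattice_def)
  then show "hex_coord1 x \<in> \<int> \<and> hex_coord2 x \<in> \<int>"
    by (simp add: hex_coord_add hex_coord_scaleR hex_coord_uv)
next
  assume "hex_coord1 x \<in> \<int> \<and> hex_coord2 x \<in> \<int>"
  then obtain m n where "hex_coord1 x = of_int m" "hex_coord2 x = of_int n"
    by (auto elim!: Ints_cases)
  then have "x = of_int (m + n) *\<^sub>R hex_u + of_int n *\<^sub>R hex_v"
    by (intro hex_coord_eqI) (simp_all add: hex_coord_add hex_coord_scaleR hex_coord_uv)
  then show "x \<in> hex_lattice"
    unfolding hex_lattice_def by blast
qed

lemma hex_lattice_add: "x \<in> hex_lattice \<Longrightarrow> y \<in> hex_lattice \<Longrightarrow> x + y \<in> hex_lattice"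
  and hex_lattice_diff: "x \<in> hex_lattice \<Longrightarrow> y \<in> hex_lattice \<Longrightarrow> x - y \<in> hex_lattice"
  and hex_lattice_uminus_iff: "- x \<in> hex_lattice \<longleftrightarrow> x \<in> hex_lattice"
  and hex_lattice_scale: "x \<in> hex_lattice \<Longrightarrow> of_int k *\<^sub>R x \<in> hex_lattice"
  by (auto simp: mem_hex_lattice_iff hex_coord_add hex_coord_diff hex_coord_uminus hex_coord_scaleR
      intro: Ints_add Ints_diff Ints_mult)

lemma closed_hex_lattice: "closed hex_lattice"
proof -
  have "continuous_on UNIV hex_coord1" "continuous_on UNIV hex_coord2"
    unfolding hex_coord1_def[abs_def] hex_coord2_def[abs_def] by (intro continuous_intros; simp)+
  moreover have "hex_lattice = hex_coord1 -` \<int> \<inter> hex_coord2 -` \<int>"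
    by (auto simp: mem_hex_lattice_iff)
  ultimately show ?thesis
    by (metis closed_Int closed_Ints closed_vimage)
qed

lemma countable_hex_lattice: "countable hex_lattice"
proof -
  have eq: "hex_lattice = (\<lambda>(m, n). of_int m *\<^sub>R hex_u + of_int n *\<^sub>R hex_v) ` (UNIV :: (int \<times> int) set)"
    unfolding hex_lattice_def by auto
  show ?thesis
    unfolding eq by (rule countable_image) simp
qed

section \<open>Matrices in lattice coordinates\<close>

text \<open>The real matrix acting on lattice coordinates as \<open>[[a, b], [c, d]]\<close>, i.e.
  \<open>P [[a, b], [c, d]] P\<^sup>-\<^sup>1\<close> where \<open>P\<close> has columns \<^const>\<open>hex_e1\<close>, \<^const>\<open>hex_e2\<close>.\<close>

definition hex_matrix :: "real \<Rightarrow> real \<Rightarrow> real \<Rightarrow> real \<Rightarrow> real^2^2" where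
  "hex_matrix a b c d = vector [vector [3/2*(a+c) - (b+d)/2, sqrt 3/2*(b+d-a-c)],
     vector [sqrt 3/2*(a+3*c) - sqrt 3/6*(b+3*d), (b+3*d-a-3*c)/2]]"

lemma hex_coord_hex_matrix:
  "hex_coord1 (hex_matrix a b c d *v x) = a * hex_coord1 x + b * hex_coord2 x"
  "hex_coord2 (hex_matrix a b c d *v x) = c * hex_coord1 x + d * hex_coord2 x"
proof -
  have s: "sqrt 3 * (sqrt 3 * y) = 3 * y" for y :: real
    by (simp add: mult.assoc[symmetric])
  show "hex_coord1 (hex_matrix a b c d *v x) = a * hex_coord1 x + b * hex_coord2 x"
       "hex_coord2 (hex_matrix a b c d *v x) = c * hex_coord1 x + d * hex_coord2 x"
    by (simp_all add: hex_matrix_def hex_coord1_def hex_coord2_def matrix_vector_mult_def sum_2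
        field_simps s)
qed

lemma hex_matrix_eq_iff:
  "hex_matrix a b c d = hex_matrix a' b' c' d' \<longleftrightarrow> a = a' \<and> b = b' \<and> c = c' \<and> d = d'"
proof
  assume h: "hex_matrix a b c d = hex_matrix a' b' c' d'"
  have "hex_coord1 (hex_matrix a b c d *v x) = hex_coord1 (hex_matrix a' b' c' d' *v x)"
    "hex_coord2 (hex_matrix a b c d *v x) = hex_coord2 (hex_matrix a' b' c' d' *v x)" for x
    by (simp_all add: h)
  from this[of hex_e1] this[of hex_e2] show "a = a' \<and> b = b' \<and> c = c' \<and> d = d'"
    by (simp add: hex_coord_hex_matrix hex_coord_basis)
qed simp

lemma hex_matrix_mult:
  "hex_matrix a b c d ** hex_matrix a' b' c' d' =
     hex_matrix (a*a' + b*c') (a*b' + b*d') (c*a' + d*c') (c*b' + d*d')"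
  unfolding matrix_eq
  by (auto intro!: hex_coord_eqI simp: matrix_vector_mul_assoc[symmetric] hex_coord_hex_matrix algebra_simps)

lemma hex_matrix_one: "hex_matrix 1 0 0 1 = mat 1"
  unfolding matrix_eq by (auto intro!: hex_coord_eqI simp: hex_coord_hex_matrix)

lemma hex_matrix_coords:
  "A = hex_matrix (hex_coord1 (A *v hex_e1)) (hex_coord1 (A *v hex_e2))
         (hex_coord2 (A *v hex_e1)) (hex_coord2 (A *v hex_e2))"
  unfolding matrix_eq
proof
  fix x
  have "A *v x = hex_coord1 x *\<^sub>R (A *v hex_e1) + hex_coord2 x *\<^sub>R (A *v hex_e2)"
    by (subst hex_coord_decomp[of x]) (simp add: matrix_vector_right_distrib matrix_vector_mult_scaleR)
  then show "A *v x = hex_matrix (hex_coord1 (A *v hex_e1)) (hex_coord1 (A *v hex_e2))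
         (hex_coord2 (A *v hex_e1)) (hex_coord2 (A *v hex_e2)) *v x"
    by (intro hex_coord_eqI) (simp_all add: hex_coord_hex_matrix hex_coord_add hex_coord_scaleR algebra_simps)
qed

lemma hex_matrix_inverse:
  assumes "a*d - b*c = e" "e*e = 1"
  shows "hex_matrix a b c d ** hex_matrix (e*d) (-e*b) (-e*c) (e*a) = mat 1"
    and "matrix_inv (hex_matrix a b c d) = hex_matrix (e*d) (-e*b) (-e*c) (e*a)"
proof -
  have "a*(e*d) + b*(-e*c) = e*(a*d - b*c)" "c*(-e*b) + d*(e*a) = e*(a*d - b*c)"
    by (simp_all add: algebra_simps)
  then have "a*(e*d) + b*(-e*c) = 1" "c*(-e*b) + d*(e*a) = 1"
    using assms by simp_all
  then show inv: "hex_matrix a b c d ** hex_matrix (e*d) (-e*b) (-e*c) (e*a) = mat 1"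
    by (simp add: hex_matrix_mult algebra_simps flip: hex_matrix_one)
  then show "matrix_inv (hex_matrix a b c d) = hex_matrix (e*d) (-e*b) (-e*c) (e*a)"
    by (rule matrix_inv_eqI)
qed

lemma mat_alpha_eq: "mat_alpha = hex_matrix 2 3 (-1) (-2)"
  and mat_beta_eq: "mat_beta = hex_matrix 1 3 0 (-1)"
  and mat_gamma_eq: "mat_gamma = hex_matrix 1 6 0 (-1)"
  by (simp_all add: mat_alpha_def mat_beta_def mat_gamma_def hex_matrix_def vec_eq_iff forall_2 field_simps)

section \<open>The group \<open>\<Gamma>\<close> and its generators\<close>

abbreviation hex_int_matrix :: "int \<Rightarrow> int \<Rightarrow> int \<Rightarrow> int \<Rightarrow> real^2^2" where
  "hex_int_matrix a b c d \<equiv> hex_matrix (of_int a) (of_int b) (of_int c) (of_int d)"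

definition hex_Gamma :: "(real^2^2) set" where
  "hex_Gamma = {hex_int_matrix a b c d | a b c d. \<bar>a*d - b*c\<bar> = 1 \<and> 3 dvd b}"

lemma hex_int_matrix_mult:
  "hex_int_matrix a b c d ** hex_int_matrix a' b' c' d' =
     hex_int_matrix (a*a' + b*c') (a*b' + b*d') (c*a' + d*c') (c*b' + d*d')"
  by (simp add: hex_matrix_mult)

lemma hex_int_matrix_inverse:
  assumes "a*d - b*c = e" "\<bar>e\<bar> = 1"
  shows "hex_int_matrix a b c d ** hex_int_matrix (e*d) (-e*b) (-e*c) (e*a) = mat 1"
    and "matrix_inv (hex_int_matrix a b c d) = hex_int_matrix (e*d) (-e*b) (-e*c) (e*a)"
proof -
  have "e*e = 1"
    using assms(2) by (cases "e \<ge> 0") auto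
  then have "of_int a * of_int d - of_int b * of_int c = (of_int e :: real)" "of_int e * of_int e = (1::real)"
    using assms(1) by (metis of_int_diff of_int_mult, metis of_int_1 of_int_mult)
  from hex_matrix_inverse[OF this] show
    "hex_int_matrix a b c d ** hex_int_matrix (e*d) (-e*b) (-e*c) (e*a) = mat 1"
    "matrix_inv (hex_int_matrix a b c d) = hex_int_matrix (e*d) (-e*b) (-e*c) (e*a)"
    by simp_all
qed

lemma hex_int_matrix_in_Gamma: "\<bar>a*d - b*c\<bar> = 1 \<Longrightarrow> 3 dvd b \<Longrightarrow> hex_int_matrix a b c d \<in> hex_Gamma"
  unfolding hex_Gamma_def by blast

lemma hex_Gamma_one: "mat 1 \<in> hex_Gamma"
  using hex_int_matrix_in_Gamma[of 1 1 0 0] by (simp add: hex_matrix_one)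

lemma hex_Gamma_mult:
  assumes "A \<in> hex_Gamma" "B \<in> hex_Gamma"
  shows "A ** B \<in> hex_Gamma"
proof -
  obtain a b c d a' b' c' d' where A: "A = hex_int_matrix a b c d" "\<bar>a*d - b*c\<bar> = 1" "3 dvd b"
    and B: "B = hex_int_matrix a' b' c' d'" "\<bar>a'*d' - b'*c'\<bar> = 1" "3 dvd b'"
    using assms unfolding hex_Gamma_def by blast
  have "(a*a' + b*c')*(c*b' + d*d') - (a*b' + b*d')*(c*a' + d*c') = (a*d - b*c)*(a'*d' - b'*c')"
    by (simp add: algebra_simps)
  then have "\<bar>(a*a' + b*c')*(c*b' + d*d') - (a*b' + b*d')*(c*a' + d*c')\<bar> = 1"
    using A(2) B(2) by (simp add: abs_mult)
  then show ?thesis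
    unfolding A(1) B(1) hex_int_matrix_mult using A(3) B(3) by (intro hex_int_matrix_in_Gamma) simp_all
qed

lemma hex_Gamma_inverse:
  assumes "A \<in> hex_Gamma"
  shows "matrix_inv A \<in> hex_Gamma" and "invertible A"
proof -
  obtain a b c d where A: "A = hex_int_matrix a b c d" "\<bar>a*d - b*c\<bar> = 1" "3 dvd b"
    using assms unfolding hex_Gamma_def by blast
  define e where "e = a*d - b*c"
  have e: "a*d - b*c = e" "\<bar>e\<bar> = 1"
    using A(2) by (simp_all add: e_def)
  then have "e*e = 1"
    by (cases "e \<ge> 0") auto
  moreover have "(e*d)*(e*a) - (-e*b)*(-e*c) = (e*e)*(a*d - b*c)"
    by (simp add: algebra_simps)
  ultimately have "\<bar>(e*d)*(e*a) - (-e*b)*(-e*c)\<bar> = 1"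
    using e by simp
  then show "matrix_inv A \<in> hex_Gamma"
    unfolding A(1) hex_int_matrix_inverse(2)[OF e] using A(3) by (intro hex_int_matrix_in_Gamma) simp_all
  show "invertible A"
    unfolding invertible_def A(1)
    using hex_int_matrix_inverse(1)[OF e] matrix_left_right_inverse by blast
qed

abbreviation hex_gen :: "(real^2^2) set" where
  "hex_gen \<equiv> generated (**) (mat 1) matrix_inv {mat_alpha, mat_beta, mat_gamma}"

lemma hex_gen_subset_Gamma: "hex_gen \<subseteq> hex_Gamma"
proof
  have generators: "mat_alpha \<in> hex_Gamma" "mat_beta \<in> hex_Gamma" "mat_gamma \<in> hex_Gamma"
    using hex_int_matrix_in_Gamma[of 2 "-2" 3 "-1"] hex_int_matrix_in_Gamma[of 1 "-1" 3 0]
      hex_int_matrix_in_Gamma[of 1 "-1" 6 0]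
    by (simp_all add: mat_alpha_eq mat_beta_eq mat_gamma_eq)
  fix A assume "A \<in> hex_gen"
  then show "A \<in> hex_Gamma"
    by induction (use generators hex_Gamma_one hex_Gamma_mult hex_Gamma_inverse in auto)
qed

lemma hex_gen_upper: "hex_int_matrix 1 (3*k) 0 1 \<in> hex_gen"
proof (rule int_family_in_generated[where F = "\<lambda>k. hex_int_matrix 1 (3*k) 0 1"])
  have "hex_matrix 1 3 0 1 = mat_beta ** mat_gamma"
    by (simp add: mat_beta_eq mat_gamma_eq hex_matrix_mult)
  then show up: "hex_int_matrix 1 (3*1) 0 1 \<in> hex_gen"
    by (simp add: generated.gen_mult generated.gen_base)
  have "matrix_inv (hex_int_matrix 1 3 0 1) = hex_int_matrix 1 (-3) 0 1"
    using hex_int_matrix_inverse(2)[of 1 1 3 0 1] by simp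
  then show "hex_int_matrix 1 (3*(-1)) 0 1 \<in> hex_gen"
    using generated.gen_inv[OF up] by simp
qed (simp_all add: hex_matrix_mult hex_matrix_one algebra_simps)

lemma hex_gen_upper_inverse: "hex_matrix 1 (-3) 0 1 \<in> hex_gen"
  using hex_gen_upper[of "-1"] by simp

lemma hex_gen_rotation_square:
  "mat_alpha ** mat_beta ** (mat_alpha ** mat_beta) = hex_matrix 1 3 (-1) (-2)"
  "mat_alpha ** mat_beta ** (mat_alpha ** mat_beta) \<in> hex_gen"
  by (simp add: mat_alpha_eq mat_beta_eq hex_matrix_mult)
    (intro generated.gen_mult generated.gen_base; simp)

lemma hex_gen_lower: "hex_int_matrix 1 0 k 1 \<in> hex_gen"
proof (rule int_family_in_generated[where F = "\<lambda>k. hex_int_matrix 1 0 k 1"])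
  have "hex_matrix 1 0 (-1) 1 = hex_matrix 1 3 (-1) (-2) ** hex_matrix 1 (-3) 0 1"
    by (simp add: hex_matrix_mult)
  then show down: "hex_int_matrix 1 0 (-1) 1 \<in> hex_gen"
    using hex_gen_rotation_square hex_gen_upper_inverse by (simp add: generated.gen_mult)
  have "matrix_inv (hex_int_matrix 1 0 (-1) 1) = hex_int_matrix 1 0 1 1"
    using hex_int_matrix_inverse(2)[of 1 1 0 "-1" 1] by simp
  then show "hex_int_matrix 1 0 1 1 \<in> hex_gen"
    using generated.gen_inv[OF down] by simp
qed (simp_all add: hex_matrix_mult hex_matrix_one)

lemma hex_gen_diagonal:
  assumes "\<bar>a\<bar> = 1" "\<bar>d\<bar> = 1"
  shows "hex_int_matrix a 0 0 d \<in> hex_gen"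
proof -
  have reflection: "hex_matrix 1 0 0 (-1) = mat_beta ** hex_matrix 1 (-3) 0 1"
    by (simp add: mat_beta_eq hex_matrix_mult)
  have minus_one: "hex_matrix (-1) 0 0 (-1) = hex_matrix 1 3 (-1) (-2) ** (mat_alpha ** mat_beta)"
    by (simp add: mat_alpha_eq mat_beta_eq hex_matrix_mult)
  have "hex_matrix 1 0 0 (-1) \<in> hex_gen" "hex_matrix (-1) 0 0 (-1) \<in> hex_gen"
    unfolding reflection minus_one
    using hex_gen_upper_inverse hex_gen_rotation_square by (auto intro: generated.gen_mult generated.gen_base)
  moreover have "hex_matrix (-1) 0 0 1 = hex_matrix (-1) 0 0 (-1) ** hex_matrix 1 0 0 (-1)"
    by (simp add: hex_matrix_mult)
  ultimately have "hex_matrix (-1) 0 0 1 \<in> hex_gen"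
    by (simp add: generated.gen_mult)
  moreover have "a = 1 \<or> a = -1" "d = 1 \<or> d = -1"
    using assms by auto
  moreover have "hex_matrix 1 0 0 1 \<in> hex_gen"
    by (simp add: hex_matrix_one generated.gen_one)
  ultimately show ?thesis
    using \<open>hex_matrix 1 0 0 (-1) \<in> hex_gen\<close> \<open>hex_matrix (-1) 0 0 (-1) \<in> hex_gen\<close> by auto
qed

text \<open>Reducing \<open>a\<close> symmetrically modulo \<open>3c\<close> and then \<open>c\<close> modulo the new \<open>a\<close> shrinks \<open>|c|\<close> to at
  most \<open>3|c|/4\<close>; the new \<open>a\<close> is nonzero because \<open>3 | b\<close> rules out \<open>b c = \<plusminus>1\<close>.\<close>
lemma hex_Gamma_descent:
  fixes a b c d :: int
  assumes det: "\<bar>a*d - b*c\<bar> = 1" and "3 dvd b" "c \<noteq> 0"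
  obtains k j a' b' c' d' where "\<bar>a'*d' - b'*c'\<bar> = 1" "3 dvd b'" "\<bar>c'\<bar> < \<bar>c\<bar>"
    "hex_int_matrix a b c d =
       hex_int_matrix 1 (3*k) 0 1 ** (hex_int_matrix 1 0 j 1 ** hex_int_matrix a' b' c' d')"
proof -
  obtain k where k: "2 * \<bar>a + k * (3*c)\<bar> \<le> \<bar>3*c\<bar>"
    using exists_symmetric_remainder \<open>c \<noteq> 0\<close> by (metis mult_eq_0_iff zero_neq_numeral)
  define a' b' where "a' = a + k * (3*c)" and "b' = b + k * (3*d)"
  have "3 dvd b'"
    using \<open>3 dvd b\<close> by (simp add: b'_def)
  have "a' \<noteq> 0"
  proof
    assume "a' = 0"
    moreover have "a'*d - b'*c = a*d - b*c"
      by (simp add: a'_def b'_def algebra_simps)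
    ultimately have "\<bar>b' * c\<bar> = 1"
      using det by simp
    moreover have "3 dvd b' * c"
      using \<open>3 dvd b'\<close> by simp
    ultimately show False
      by (auto simp: abs_if split: if_splits)
  qed
  then obtain j where j: "2 * \<bar>c + j * a'\<bar> \<le> \<bar>a'\<bar>"
    using exists_symmetric_remainder by metis
  define c' d' where "c' = c + j * a'" and "d' = d + j * b'"
  have "a'*d' - b'*c' = a*d - b*c"
    by (simp add: a'_def b'_def c'_def d'_def algebra_simps)
  then have "\<bar>a'*d' - b'*c'\<bar> = 1"
    using det by simp
  moreover have "\<bar>c'\<bar> < \<bar>c\<bar>"
  proof -
    have "2 * \<bar>a'\<bar> \<le> 3 * \<bar>c\<bar>"
      using k by (simp add: a'_def abs_mult)
    then show ?thesis
      using j[folded c'_def] \<open>c \<noteq> 0\<close> by linarith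
  qed
  moreover have "hex_int_matrix a b c d =
      hex_int_matrix 1 (3*(-k)) 0 1 ** (hex_int_matrix 1 0 (-j) 1 ** hex_int_matrix a' b' c' d')"
    by (simp add: hex_matrix_mult hex_matrix_eq_iff a'_def b'_def c'_def d'_def algebra_simps)
  ultimately show thesis
    using that \<open>3 dvd b'\<close> by blast
qed

lemma hex_Gamma_subset_gen: "hex_Gamma \<subseteq> hex_gen"
proof
  have "hex_int_matrix a b c d \<in> hex_gen" if "\<bar>a*d - b*c\<bar> = 1" "3 dvd b" for a b c d
    using that
  proof (induction "nat \<bar>c\<bar>" arbitrary: a b c d rule: less_induct)
    case less
    show ?case
    proof (cases "c = 0")
      case True
      then have "\<bar>a\<bar> * \<bar>d\<bar> = 1"
        using less.prems(1) by (simp add: abs_mult)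
      then have "\<bar>a\<bar> = 1" "\<bar>d\<bar> = 1"
        using zmult_eq_1_iff by fastforce+
      moreover obtain k where "b = 3*k"
        using less.prems(2) by blast
      ultimately have "hex_int_matrix a b c d = hex_int_matrix 1 (3*(k*d)) 0 1 ** hex_int_matrix a 0 0 d"
        using \<open>c = 0\<close> by (simp add: hex_matrix_mult abs_if split: if_splits)
      then show ?thesis
        using generated.gen_mult[OF hex_gen_upper[of "k*d"] hex_gen_diagonal[OF \<open>\<bar>a\<bar> = 1\<close> \<open>\<bar>d\<bar> = 1\<close>]]
        by simp
    next
      case False
      then obtain k j a' b' c' d' where "\<bar>a'*d' - b'*c'\<bar> = 1" "3 dvd b'" "\<bar>c'\<bar> < \<bar>c\<bar>"
        and eq: "hex_int_matrix a b c d =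
          hex_int_matrix 1 (3*k) 0 1 ** (hex_int_matrix 1 0 j 1 ** hex_int_matrix a' b' c' d')"
        using hex_Gamma_descent less.prems by metis
      then have "hex_int_matrix a' b' c' d' \<in> hex_gen"
        using less.hyps by simp
      then show ?thesis
        unfolding eq using hex_gen_upper hex_gen_lower by (simp add: generated.gen_mult)
    qed
  qed
  then show "A \<in> hex_gen" if "A \<in> hex_Gamma" for A
    using that unfolding hex_Gamma_def by blast
qed

section \<open>The torus \<open>S\<^sub>E\<close>\<close>

abbreviation hex_proj :: "real^2 \<Rightarrow> hex_torus" where
  "hex_proj \<equiv> abs_hex_torus"

lemma hex_proj_eq_iff: "hex_proj x = hex_proj y \<longleftrightarrow> x - y \<in> hex_lattice"
  by (simp add: hex_torus.abs_eq_iff tor_rel_def)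

lemma hex_proj_rep: "hex_proj (rep_hex_torus p) = p"
  by (rule Quotient3_abs_rep[OF Quotient3_hex_torus])

lemma continuous_on_hex_proj: "continuous_on UNIV hex_proj"
  by (simp add: continuous_on_open_vimage open_hex_torus_def)

lemma open_hex_proj_image:
  assumes "open S"
  shows "open (hex_proj ` S)"
proof -
  have "hex_proj -` (hex_proj ` S) = (\<Union>l\<in>hex_lattice. (\<lambda>x. l + x) ` S)"
  proof (intro set_eqI iffI)
    fix z assume "z \<in> hex_proj -` (hex_proj ` S)"
    then obtain w where "w \<in> S" "z - w \<in> hex_lattice"
      by (auto simp: hex_proj_eq_iff)
    then show "z \<in> (\<Union>l\<in>hex_lattice. (\<lambda>x. l + x) ` S)"
      by (auto intro!: bexI[of _ "z - w"] image_eqI[of _ _ w])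
  next
    fix z assume "z \<in> (\<Union>l\<in>hex_lattice. (\<lambda>x. l + x) ` S)"
    then obtain l w where "l \<in> hex_lattice" "w \<in> S" "z = l + w"
      by auto
    then have "hex_proj z = hex_proj w"
      by (simp add: hex_proj_eq_iff)
    then show "z \<in> hex_proj -` (hex_proj ` S)"
      using \<open>w \<in> S\<close> by simp
  qed
  then show ?thesis
    using assms by (simp add: open_hex_torus_def open_UN open_translation)
qed

instance hex_torus :: t2_space
proof
  fix p q :: hex_torus
  assume "p \<noteq> q"
  obtain x y where p: "p = hex_proj x" and q: "q = hex_proj y"
    by (metis hex_proj_rep)
  have "x - y \<in> - hex_lattice"
    using \<open>p \<noteq> q\<close> by (simp add: p q hex_proj_eq_iff)
  then obtain e where "e > 0" and e: "ball (x - y) e \<subseteq> - hex_lattice"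
    using closed_hex_lattice open_contains_ball by (metis open_Compl)
  have "hex_proj ` ball x (e/2) \<inter> hex_proj ` ball y (e/2) = {}"
  proof (rule ccontr)
    assume "hex_proj ` ball x (e/2) \<inter> hex_proj ` ball y (e/2) \<noteq> {}"
    then obtain w1 w2 where w: "w1 \<in> ball x (e/2)" "w2 \<in> ball y (e/2)" "w1 - w2 \<in> hex_lattice"
      by (auto simp: hex_proj_eq_iff)
    have "dist (x - y) (w1 - w2) = norm ((x - w1) - (y - w2))"
      by (simp add: dist_norm algebra_simps)
    also have "\<dots> \<le> dist x w1 + dist y w2"
      by (simp add: dist_norm norm_triangle_ineq4)
    finally have "w1 - w2 \<in> ball (x - y) e"
      using w by simp
    then show False
      using e w(3) by blast
  qed
  then show "\<exists>U V. open U \<and> open V \<and> p \<in> U \<and> q \<in> V \<and> U \<inter> V = {}"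
    using \<open>e > 0\<close> by (intro exI[of _ "hex_proj ` ball x (e/2)"] exI[of _ "hex_proj ` ball y (e/2)"])
      (auto simp: p q open_hex_proj_image)
qed

definition hex_vertex :: "real^2" where "hex_vertex = vector [1, 0]"

lemma hex_Sigma_eq: "hex_Sigma = {hex_proj hex_vertex, hex_proj (- hex_vertex)}"
proof -
  have "(vector [-1, 0] :: real^2) = - hex_vertex"
    by (simp add: hex_vertex_def vec_eq_iff forall_2)
  then show ?thesis
    by (simp add: hex_Sigma_def hex_vertex_def)
qed

lemma hex_proj_in_Sigma_iff:
  "hex_proj x \<in> hex_Sigma \<longleftrightarrow> x - hex_vertex \<in> hex_lattice \<or> x + hex_vertex \<in> hex_lattice"
  by (auto simp: hex_Sigma_eq hex_proj_eq_iff)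

lemma hex_coord_vertex: "hex_coord1 hex_vertex = 1" "hex_coord2 hex_vertex = -1/3"
  by (simp_all add: hex_vertex_def hex_coord1_def hex_coord2_def)

lemma hex_Sigma_three_torsion:
  assumes "hex_proj x \<in> hex_Sigma"
  shows "3 *\<^sub>R x \<in> hex_lattice"
proof -
  have "3 *\<^sub>R hex_vertex \<in> hex_lattice"
    by (simp add: mem_hex_lattice_iff hex_coord_scaleR hex_coord_vertex)
  moreover have "3 *\<^sub>R (x - hex_vertex) \<in> hex_lattice \<or> 3 *\<^sub>R (x + hex_vertex) \<in> hex_lattice"
    using assms hex_lattice_scale[of _ 3] by (auto simp: hex_proj_in_Sigma_iff)
  moreover have "3 *\<^sub>R x = 3 *\<^sub>R (x - hex_vertex) + 3 *\<^sub>R hex_vertex"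
    "3 *\<^sub>R x = 3 *\<^sub>R (x + hex_vertex) - 3 *\<^sub>R hex_vertex"
    by (simp_all add: scaleR_diff_right scaleR_add_right)
  ultimately show ?thesis
    by (metis hex_lattice_add hex_lattice_diff)
qed

lemma countable_hex_proj_vimage_Sigma: "countable (hex_proj -` hex_Sigma)"
proof (rule countable_subset)
  show "hex_proj -` hex_Sigma \<subseteq> (\<lambda>l. l + hex_vertex) ` hex_lattice \<union> (\<lambda>l. l - hex_vertex) ` hex_lattice"
  proof
    fix x assume "x \<in> hex_proj -` hex_Sigma"
    then have "x - hex_vertex \<in> hex_lattice \<or> x + hex_vertex \<in> hex_lattice"
      by (simp add: hex_proj_in_Sigma_iff)
    moreover have "x = (x - hex_vertex) + hex_vertex" "x = (x + hex_vertex) - hex_vertex"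
      by simp_all
    ultimately show "x \<in> (\<lambda>l. l + hex_vertex) ` hex_lattice \<union> (\<lambda>l. l - hex_vertex) ` hex_lattice"
      by blast
  qed
  show "countable ((\<lambda>l. l + hex_vertex) ` hex_lattice \<union> (\<lambda>l. l - hex_vertex) ` hex_lattice)"
    using countable_hex_lattice by simp
qed

section \<open>Affine automorphisms induced by \<open>\<Gamma>\<close>\<close>

definition lattice_stable :: "real^2^2 \<Rightarrow> bool" where
  "lattice_stable A \<longleftrightarrow> (\<forall>x\<in>hex_lattice. A *v x \<in> hex_lattice)"

definition torus_map :: "real^2^2 \<Rightarrow> hex_torus \<Rightarrow> hex_torus" where
  "torus_map A p = hex_proj (A *v rep_hex_torus p)"

lemma torus_map_proj:
  assumes "lattice_stable A"
  shows "torus_map A (hex_proj x) = hex_proj (A *v x)"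
proof -
  have "rep_hex_torus (hex_proj x) - x \<in> hex_lattice"
    using hex_proj_rep[of "hex_proj x"] by (simp add: hex_proj_eq_iff)
  then have "A *v (rep_hex_torus (hex_proj x) - x) \<in> hex_lattice"
    using assms by (simp add: lattice_stable_def)
  then show ?thesis
    by (simp add: torus_map_def hex_proj_eq_iff matrix_vector_mult_diff_distrib)
qed

lemma torus_map_mult:
  assumes "lattice_stable A" "lattice_stable B"
  shows "torus_map (A ** B) = torus_map A \<circ> torus_map B"
proof
  fix p
  have "torus_map A (torus_map B p) = hex_proj (A *v (B *v rep_hex_torus p))"
    unfolding torus_map_def[of B] by (rule torus_map_proj[OF assms(1)])
  then show "torus_map (A ** B) p = (torus_map A \<circ> torus_map B) p"
    by (simp add: torus_map_def matrix_vector_mul_assoc)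
qed

lemma torus_map_one: "torus_map (mat 1) = id"
  by (simp add: fun_eq_iff torus_map_def hex_proj_rep)

lemma continuous_on_torus_map:
  assumes "lattice_stable A"
  shows "continuous_on UNIV (torus_map A)"
proof -
  have "hex_proj -` (torus_map A -` U) = (\<lambda>x. A *v x) -` (hex_proj -` U)" for U
    by (auto simp: torus_map_proj[OF assms])
  then show ?thesis
    unfolding continuous_on_open_vimage[OF open_UNIV]
    by (simp add: open_hex_torus_def open_vimage matrix_vector_mult_linear_continuous_on)
qed

lemma lattice_stable_hex_int_matrix: "lattice_stable (hex_int_matrix a b c d)"
  by (auto simp: lattice_stable_def mem_hex_lattice_iff hex_coord_hex_matrix elim!: Ints_cases)

lemma hex_Gamma_lattice_stable: "A \<in> hex_Gamma \<Longrightarrow> lattice_stable A"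
  unfolding hex_Gamma_def using lattice_stable_hex_int_matrix by blast

lemma torus_map_inverse:
  assumes "A \<in> hex_Gamma"
  shows "torus_map A \<circ> torus_map (matrix_inv A) = id" "torus_map (matrix_inv A) \<circ> torus_map A = id"
  using assms hex_Gamma_inverse[OF assms] invertible_matrix_inv_mult[of A]
  by (simp_all add: torus_map_one hex_Gamma_lattice_stable flip: torus_map_mult)

lemma inv_torus_map: "A \<in> hex_Gamma \<Longrightarrow> inv (torus_map A) = torus_map (matrix_inv A)"
  by (rule inv_unique_comp) (simp_all add: torus_map_inverse)

lemma hex_Gamma_vertex:
  assumes "A \<in> hex_Gamma"
  shows "hex_proj (A *v hex_vertex) \<in> hex_Sigma"
proof -
  obtain a b c d where A: "A = hex_int_matrix a b c d" "\<bar>a*d - b*c\<bar> = 1" and "3 dvd b"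
    using assms unfolding hex_Gamma_def by blast
  then obtain k where k: "b = 3*k"
    by blast
  have "\<not> 3 dvd d"
  proof
    assume "3 dvd d"
    then have "3 dvd \<bar>a*d - b*c\<bar>"
      using k by simp
    with A(2) show False
      by simp
  qed
  then have "\<exists>l. d = 3*l + 1 \<or> d = 3*l - 1"
    by presburger
  then consider l where "d = 3*l + 1" | l where "d = 3*l - 1"
    by blast
  then show ?thesis
  proof cases
    case (1 l)
    have "hex_coord1 (A *v hex_vertex - hex_vertex) = of_int (a - k - 1)"
      "hex_coord2 (A *v hex_vertex - hex_vertex) = of_int (c - l)"
      by (simp_all add: A(1) k 1 hex_coord_diff hex_coord_hex_matrix hex_coord_vertex algebra_simps)
    then show ?thesis
      by (simp add: hex_proj_in_Sigma_iff mem_hex_lattice_iff)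
  next
    case (2 l)
    have "hex_coord1 (A *v hex_vertex + hex_vertex) = of_int (a - k + 1)"
      "hex_coord2 (A *v hex_vertex + hex_vertex) = of_int (c - l)"
      by (simp_all add: A(1) k 2 hex_coord_add hex_coord_hex_matrix hex_coord_vertex algebra_simps)
    then show ?thesis
      by (simp add: hex_proj_in_Sigma_iff mem_hex_lattice_iff)
  qed
qed

lemma torus_map_Sigma:
  assumes "A \<in> hex_Gamma"
  shows "torus_map A ` hex_Sigma = hex_Sigma"
proof -
  have "A *v (- hex_vertex) = - (A *v hex_vertex)"
    by (simp add: matrix_vector_mult_def vec_eq_iff sum_negf)
  then have image: "torus_map A ` hex_Sigma = {hex_proj (A *v hex_vertex), hex_proj (- (A *v hex_vertex))}"
    by (simp only: hex_Sigma_eq image_insert image_empty torus_map_proj[OF hex_Gamma_lattice_stable[OF assms]])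
  have neg: "hex_proj (- x) = hex_proj (- y)" if "hex_proj x = hex_proj y" for x y
    using that hex_lattice_uminus_iff[of "x - y"] by (simp add: hex_proj_eq_iff)
  have "hex_proj (A *v hex_vertex) = hex_proj hex_vertex \<or>
      hex_proj (A *v hex_vertex) = hex_proj (- hex_vertex)"
    using hex_Gamma_vertex[OF assms] by (simp add: hex_Sigma_eq)
  then show ?thesis
  proof
    assume "hex_proj (A *v hex_vertex) = hex_proj hex_vertex"
    moreover from this have "hex_proj (- (A *v hex_vertex)) = hex_proj (- hex_vertex)"
      by (rule neg)
    ultimately show ?thesis
      unfolding image by (simp add: hex_Sigma_eq)
  next
    assume "hex_proj (A *v hex_vertex) = hex_proj (- hex_vertex)"
    moreover from neg[OF this] have "hex_proj (- (A *v hex_vertex)) = hex_proj hex_vertex"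
      by simp
    ultimately show ?thesis
      unfolding image by (simp add: hex_Sigma_eq insert_commute)
  qed
qed

lemma hex_Gamma_affine_aut:
  assumes "A \<in> hex_Gamma"
  shows "is_affine_aut (torus_map A) A"
  unfolding is_affine_aut_def
proof (intro conjI exI allI impI)
  have "lattice_stable A" "lattice_stable (matrix_inv A)"
    using assms hex_Gamma_inverse(1) hex_Gamma_lattice_stable by blast+
  then show "homeomorphism UNIV UNIV (torus_map A) (torus_map (matrix_inv A))"
    using torus_map_inverse[OF assms] continuous_on_torus_map
    by (auto simp: homeomorphism_def fun_eq_iff image_iff) (metis comp_apply id_apply)+
  show "torus_map A ` hex_Sigma = hex_Sigma"
    by (rule torus_map_Sigma[OF assms])
  show "invertible A"
    by (rule hex_Gamma_inverse(2)[OF assms])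
  fix p
  show "open UNIV" "p \<in> UNIV" "\<forall>x\<in>UNIV. torus_map A (hex_proj x) = hex_proj (A *v x + 0)"
    by (simp_all add: torus_map_proj hex_Gamma_lattice_stable[OF assms])
qed

section \<open>Every affine automorphism comes from \<open>\<Gamma>\<close>\<close>

lemma affine_aut_local_lifts:
  assumes "is_affine_aut \<Psi> A"
  obtains U loc where "\<And>p. hex_proj p \<notin> hex_Sigma \<Longrightarrow> open (U p)"
    and "\<And>p. hex_proj p \<notin> hex_Sigma \<Longrightarrow> p \<in> U p"
    and "\<And>p x. hex_proj p \<notin> hex_Sigma \<Longrightarrow> x \<in> U p \<Longrightarrow> \<Psi> (hex_proj x) = hex_proj (A *v x + loc p)"
proof -
  have "\<forall>p. \<exists>V c. hex_proj p \<notin> hex_Sigma \<longrightarrow>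
      open V \<and> p \<in> V \<and> (\<forall>x\<in>V. \<Psi> (hex_proj x) = hex_proj (A *v x + c))"
    using assms unfolding is_affine_aut_def by blast
  then obtain U where "\<forall>p. \<exists>c. hex_proj p \<notin> hex_Sigma \<longrightarrow>
      open (U p) \<and> p \<in> U p \<and> (\<forall>x\<in>U p. \<Psi> (hex_proj x) = hex_proj (A *v x + c))"
    by (rule choice[THEN exE])
  then obtain loc where "\<forall>p. hex_proj p \<notin> hex_Sigma \<longrightarrow>
      open (U p) \<and> p \<in> U p \<and> (\<forall>x\<in>U p. \<Psi> (hex_proj x) = hex_proj (A *v x + loc p))"
    by (rule choice[THEN exE])
  then show thesis
    using that[of U loc] by blast
qed

lemma affine_aut_lift_off_Sigma:
  assumes "is_affine_aut \<Psi> A"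
  obtains b where "\<And>x. hex_proj x \<notin> hex_Sigma \<Longrightarrow> \<Psi> (hex_proj x) = hex_proj (A *v x + b)"
proof -
  define P where "P = hex_proj -` hex_Sigma"
  obtain U loc where U: "\<And>p. p \<notin> P \<Longrightarrow> open (U p)" "\<And>p. p \<notin> P \<Longrightarrow> p \<in> U p"
    "\<And>p x. p \<notin> P \<Longrightarrow> x \<in> U p \<Longrightarrow> \<Psi> (hex_proj x) = hex_proj (A *v x + loc p)"
    using affine_aut_local_lifts[OF assms] unfolding P_def vimage_eq by metis
  have overlap: "loc p - loc x \<in> hex_lattice" if "p \<notin> P" "x \<notin> P" "x \<in> U p" for p x
  proof -
    have "hex_proj (A *v x + loc p) = hex_proj (A *v x + loc x)"
      using U(2,3) that by metis
    then show ?thesis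
      by (simp add: hex_proj_eq_iff)
  qed
  have "countable P"
    unfolding P_def by (rule countable_hex_proj_vimage_Sigma)
  then obtain x0 where "x0 \<notin> P"
    using ball_minus_countable_nonempty[of P 1 0] by auto
  have "connected (- P)"
    using path_connected_complement_countable[OF _ \<open>countable P\<close>]
    by (simp add: path_connected_imp_connected)
  have offset: "loc x0 - loc y \<in> hex_lattice" if "y \<notin> P" for y
  proof (rule connected_equivalence_relation[OF \<open>connected (- P)\<close>,
        where R = "\<lambda>y z. loc y - loc z \<in> hex_lattice"])
    show "x0 \<in> - P" "y \<in> - P"
      using \<open>x0 \<notin> P\<close> \<open>y \<notin> P\<close> by simp_all
    show "loc z - loc y \<in> hex_lattice" if "loc y - loc z \<in> hex_lattice" for y z
      using that hex_lattice_uminus_iff[of "loc y - loc z"] by simp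
    show "loc x - loc z \<in> hex_lattice"
      if "loc x - loc y \<in> hex_lattice" "loc y - loc z \<in> hex_lattice" for x y z
      using hex_lattice_add[OF that] by simp
    show "\<exists>T. openin (top_of_set (- P)) T \<and> a \<in> T \<and> (\<forall>x\<in>T. loc a - loc x \<in> hex_lattice)"
      if "a \<in> - P" for a
      using that U(1,2) overlap by (intro exI[of _ "- P \<inter> U a"]) auto
  qed
  have "\<Psi> (hex_proj x) = hex_proj (A *v x + loc x0)" if "hex_proj x \<notin> hex_Sigma" for x
  proof -
    have "x \<notin> P"
      using that by (simp add: P_def)
    then have "\<Psi> (hex_proj x) = hex_proj (A *v x + loc x)" "loc x0 - loc x \<in> hex_lattice"
      using U(2,3) offset by simp_all
    then show ?thesis
      using hex_lattice_uminus_iff[of "loc x0 - loc x"] by (simp add: hex_proj_eq_iff)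
  qed
  then show thesis
    by (rule that)
qed

lemma affine_aut_lift:
  assumes "is_affine_aut \<Psi> A"
  obtains b where "\<And>x. \<Psi> (hex_proj x) = hex_proj (A *v x + b)"
proof -
  obtain b where b: "\<And>x. hex_proj x \<notin> hex_Sigma \<Longrightarrow> \<Psi> (hex_proj x) = hex_proj (A *v x + b)"
    using affine_aut_lift_off_Sigma[OF assms] by blast
  obtain \<Psi>' where "homeomorphism UNIV UNIV \<Psi> \<Psi>'"
    using assms unfolding is_affine_aut_def by blast
  then have "continuous_on UNIV \<Psi>"
    by (rule homeomorphism_cont1)
  then have "continuous_on UNIV (\<lambda>x. \<Psi> (hex_proj x))"
    by (rule continuous_on_compose2[OF _ continuous_on_hex_proj]) simp
  moreover have "continuous_on UNIV (\<lambda>x. A *v x + b)"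
    by (intro continuous_intros matrix_vector_mult_linear_continuous_on)
  then have "continuous_on UNIV (\<lambda>x. hex_proj (A *v x + b))"
    by (rule continuous_on_compose2[OF continuous_on_hex_proj]) simp
  ultimately have "(\<lambda>x. \<Psi> (hex_proj x)) = (\<lambda>x. hex_proj (A *v x + b))"
    using countable_hex_proj_vimage_Sigma b by (rule continuous_eq_off_countable) simp
  then show thesis
    using that by metis
qed

lemma affine_lift_lattice_stable:
  assumes "inj \<Psi>" and lift: "\<And>x. \<Psi> (hex_proj x) = hex_proj (A *v x + b)" and "invertible A"
  shows "lattice_stable A" "lattice_stable (matrix_inv A)"
proof -
  have iff: "A *v x \<in> hex_lattice \<longleftrightarrow> x \<in> hex_lattice" for x
  proof -
    have "A *v x \<in> hex_lattice \<longleftrightarrow> hex_proj (A *v x + b) = hex_proj (A *v 0 + b)"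
      by (simp add: hex_proj_eq_iff)
    also have "\<dots> \<longleftrightarrow> \<Psi> (hex_proj x) = \<Psi> (hex_proj 0)"
      by (simp only: lift)
    also have "\<dots> \<longleftrightarrow> hex_proj x = hex_proj 0"
      by (rule inj_eq[OF \<open>inj \<Psi>\<close>])
    finally show ?thesis
      by (simp add: hex_proj_eq_iff)
  qed
  then show "lattice_stable A"
    by (simp add: lattice_stable_def)
  show "lattice_stable (matrix_inv A)"
    using iff[of "matrix_inv A *v _"] invertible_matrix_inv_mult(1)[OF \<open>invertible A\<close>]
    by (simp add: lattice_stable_def matrix_vector_mul_assoc)
qed

lemma affine_aut_lift_offset:
  assumes aut: "is_affine_aut \<Psi> A" and lift: "\<And>x. \<Psi> (hex_proj x) = hex_proj (A *v x + b)"
  shows "b \<in> hex_lattice"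
proof -
  have "inj \<Psi>" "invertible A" "\<Psi> ` hex_Sigma = hex_Sigma"
    using aut unfolding is_affine_aut_def by (metis homeomorphism_def inj_on_inverseI)+
  define q q' where "q = A *v hex_vertex + b" and "q' = - (A *v hex_vertex) + b"
  have "A *v (- hex_vertex) = - (A *v hex_vertex)"
    by (simp add: matrix_vector_mult_def vec_eq_iff sum_negf)
  then have "{hex_proj q, hex_proj q'} = {hex_proj hex_vertex, hex_proj (- hex_vertex)}"
    using \<open>\<Psi> ` hex_Sigma = hex_Sigma\<close> by (simp add: hex_Sigma_eq lift q_def q'_def)
  then have "q - hex_vertex \<in> hex_lattice \<and> q' + hex_vertex \<in> hex_lattice \<or>
      q + hex_vertex \<in> hex_lattice \<and> q' - hex_vertex \<in> hex_lattice"
    by (simp add: doubleton_eq_iff hex_proj_eq_iff)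
  moreover have "2 *\<^sub>R b = (q - hex_vertex) + (q' + hex_vertex)" "2 *\<^sub>R b = (q + hex_vertex) + (q' - hex_vertex)"
    by (simp_all add: q_def q'_def scaleR_2)
  ultimately have two: "2 *\<^sub>R b \<in> hex_lattice"
    by (metis hex_lattice_add)
  have "hex_proj q \<in> hex_Sigma" "hex_proj hex_vertex \<in> hex_Sigma"
    using \<open>{hex_proj q, hex_proj q'} = _\<close> by (auto simp: hex_Sigma_eq)
  then have "3 *\<^sub>R q \<in> hex_lattice" "A *v (3 *\<^sub>R hex_vertex) \<in> hex_lattice"
    using hex_Sigma_three_torsion affine_lift_lattice_stable(1)[OF \<open>inj \<Psi>\<close> lift \<open>invertible A\<close>]
    by (auto simp: lattice_stable_def)
  moreover have "3 *\<^sub>R b = 3 *\<^sub>R q - A *v (3 *\<^sub>R hex_vertex)"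
    by (simp add: q_def scaleR_add_right matrix_vector_mult_scaleR)
  ultimately have "3 *\<^sub>R b \<in> hex_lattice"
    by (simp add: hex_lattice_diff)
  moreover have "b = 3 *\<^sub>R b - 2 *\<^sub>R b"
    by (simp flip: scaleR_left_diff_distrib)
  ultimately show ?thesis
    using two by (metis hex_lattice_diff)
qed

lemma lattice_stable_imp_hex_int_matrix:
  assumes "lattice_stable A"
  obtains a b c d where "A = hex_int_matrix a b c d"
proof -
  have "hex_e1 \<in> hex_lattice" "hex_e2 \<in> hex_lattice"
    by (simp_all add: mem_hex_lattice_iff hex_coord_basis)
  then have "A *v hex_e1 \<in> hex_lattice" "A *v hex_e2 \<in> hex_lattice"
    using assms by (simp_all add: lattice_stable_def)
  then obtain a b c d where "hex_coord1 (A *v hex_e1) = of_int a" "hex_coord1 (A *v hex_e2) = of_int b"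
    "hex_coord2 (A *v hex_e1) = of_int c" "hex_coord2 (A *v hex_e2) = of_int d"
    by (auto simp: mem_hex_lattice_iff elim!: Ints_cases)
  then show thesis
    using that hex_matrix_coords[of A] by metis
qed

lemma in_hex_GammaI:
  assumes "invertible A" "lattice_stable A" "lattice_stable (matrix_inv A)"
    and vertex: "hex_proj (A *v hex_vertex) \<in> hex_Sigma"
  shows "A \<in> hex_Gamma"
proof -
  obtain a b c d where A: "A = hex_int_matrix a b c d"
    using lattice_stable_imp_hex_int_matrix[OF assms(2)] .
  obtain a' b' c' d' where A': "matrix_inv A = hex_int_matrix a' b' c' d'"
    using lattice_stable_imp_hex_int_matrix[OF assms(3)] .
  have "hex_int_matrix a b c d ** hex_int_matrix a' b' c' d' = mat 1"
    using invertible_matrix_inv_mult(1)[OF assms(1)] unfolding A' by (simp only: A)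
  then have "hex_int_matrix (a*a' + b*c') (a*b' + b*d') (c*a' + d*c') (c*b' + d*d') = hex_matrix 1 0 0 1"
    by (simp only: hex_int_matrix_mult hex_matrix_one)
  then have "a*a' + b*c' = 1" "a*b' + b*d' = 0" "c*a' + d*c' = 0" "c*b' + d*d' = 1"
    unfolding hex_matrix_eq_iff by (simp_all only: of_int_eq_1_iff of_int_eq_0_iff)
  moreover have "(a*d - b*c) * (a'*d' - b'*c') = (a*a' + b*c')*(c*b' + d*d') - (a*b' + b*d')*(c*a' + d*c')"
    by (simp add: algebra_simps)
  ultimately have "\<bar>a*d - b*c\<bar> = 1"
    by (auto simp: zmult_eq_1_iff)
  have "hex_coord1 (A *v hex_vertex) - 1 \<in> \<int> \<or> hex_coord1 (A *v hex_vertex) + 1 \<in> \<int>"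
    using vertex by (auto simp: hex_proj_in_Sigma_iff mem_hex_lattice_iff hex_coord_diff hex_coord_add hex_coord_vertex)
  then have "hex_coord1 (A *v hex_vertex) \<in> \<int>"
    by (metis Ints_1 Ints_add Ints_diff add_diff_cancel diff_add_cancel)
  then have "of_int a - hex_coord1 (A *v hex_vertex) \<in> \<int>"
    by simp
  then have "(of_int b / 3 :: real) \<in> \<int>"
    by (simp add: A hex_coord_hex_matrix hex_coord_vertex)
  then obtain k where "(of_int b :: real) = 3 * of_int k"
    by (auto elim!: Ints_cases simp: field_simps)
  then have "b = 3 * k"
    by linarith
  then show ?thesis
    unfolding A using \<open>\<bar>a*d - b*c\<bar> = 1\<close> by (intro hex_int_matrix_in_Gamma) simp_all
qed

lemma affine_aut_characterization:
  assumes "is_affine_aut \<Psi> A"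
  shows "A \<in> hex_Gamma" and "\<Psi> = torus_map A"
proof -
  obtain b where lift: "\<And>x. \<Psi> (hex_proj x) = hex_proj (A *v x + b)"
    using affine_aut_lift[OF assms] by blast
  have "inj \<Psi>" "invertible A"
    using assms unfolding is_affine_aut_def by (metis homeomorphism_def inj_on_inverseI)+
  note stable = affine_lift_lattice_stable[OF this(1) lift this(2)]
  have "b \<in> hex_lattice"
    by (rule affine_aut_lift_offset[OF assms lift])
  then have proj: "\<Psi> (hex_proj x) = hex_proj (A *v x)" for x
    by (simp add: lift hex_proj_eq_iff)
  then show "\<Psi> = torus_map A"
    by (metis ext hex_proj_rep torus_map_proj[OF stable(1)])
  have "\<Psi> (hex_proj hex_vertex) \<in> hex_Sigma"
    using assms unfolding is_affine_aut_def hex_Sigma_eq by blast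
  then show "A \<in> hex_Gamma"
    using \<open>invertible A\<close> stable by (intro in_hex_GammaI) (simp_all add: proj)
qed

lemma Veech_SE_eq: "Veech_SE = hex_Gamma"
  unfolding Veech_SE_def using affine_aut_characterization(1) hex_Gamma_affine_aut by blast

lemma Aff_SE_eq: "Aff_SE = torus_map ` hex_Gamma"
  unfolding Aff_SE_def using affine_aut_characterization hex_Gamma_affine_aut by blast

theorem mainTheorem2:
  shows "(\<forall>\<Psi>1 \<Psi>2 A. is_affine_aut \<Psi>1 A \<and> is_affine_aut \<Psi>2 A \<longrightarrow> \<Psi>1 = \<Psi>2)
    \<and> (\<exists>\<Psi>\<alpha> \<Psi>\<beta> \<Psi>\<gamma>. is_affine_aut \<Psi>\<alpha> mat_alpha \<and> is_affine_aut \<Psi>\<beta> mat_beta \<and>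
         is_affine_aut \<Psi>\<gamma> mat_gamma \<and>
         Aff_SE = generated (\<circ>) id inv {\<Psi>\<alpha>, \<Psi>\<beta>, \<Psi>\<gamma>})
    \<and> Veech_SE = generated (**) (mat 1) matrix_inv {mat_alpha, mat_beta, mat_gamma}"
proof -
  have Gamma: "hex_Gamma = hex_gen"
    using hex_gen_subset_Gamma hex_Gamma_subset_gen by blast
  have "Aff_SE = generated (\<circ>) id inv (torus_map ` {mat_alpha, mat_beta, mat_gamma})"
    unfolding Aff_SE_eq Gamma
  proof (rule generated_hom_image)
    show "torus_map (A ** B) = torus_map A \<circ> torus_map B" if "A \<in> hex_gen" "B \<in> hex_gen" for A B
      using that hex_gen_subset_Gamma by (intro torus_map_mult hex_Gamma_lattice_stable) auto
    show "torus_map (matrix_inv A) = inv (torus_map A)" if "A \<in> hex_gen" for A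
      using that hex_gen_subset_Gamma inv_torus_map by auto
  qed (rule torus_map_one)
  then have "Aff_SE = generated (\<circ>) id inv {torus_map mat_alpha, torus_map mat_beta, torus_map mat_gamma}"
    by simp
  moreover have "mat_alpha \<in> hex_Gamma" "mat_beta \<in> hex_Gamma" "mat_gamma \<in> hex_Gamma"
    unfolding Gamma by (simp_all add: generated.gen_base)
  ultimately show ?thesis
    using affine_aut_characterization(2) hex_Gamma_affine_aut Gamma Veech_SE_eq by metis
qed

end
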